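(* Let $q\ge 1$ be an integer, and let $\tau$ be the shipment-release time of a renewal-type clearing policy with the same expected consolidation cycle length as the quantity-based policy QP with parameter $q$, i.e. $\mathbb{E}[\tau]=\mathbb{E}[\tau_q]=q/\lambda$. Then QP outperforms this policy in terms of average order delay: if the policy differs from QP, i.e. $\mathbb{P}(\tau\neq\tau_q)>0$, then $$AOD_{QP}=AOD_{\tau_q}<AOD_\tau .$$
   Context: Customer orders arrive according to a Poisson process $\{N(t)\}_{t\ge 0}$ with rate $\lambda>0$ and $N(0)=0$. Let $\mathcal{G}_t$ be the $\sigma$-field generated by $\{N(s): s\in[0,t]\}$, and let $\tau_n$ be the arrival time of the $n$-th order. A renewal-type clearing policy is specified by its shipment-release time $\tau$ (the length of one consolidation cycle started at time $0$), which is a $\{\mathcal{G}_t\}$-stopping time with $0<\mathbb{E}[\tau]<\infty$; at time $\tau$ all waiting orders are dispatched and the system restarts. The cumulative waiting time in one cycle is $W(\tau)=\int_0^\tau N(u)\,du$, and the average order delay is $$AOD_\tau=\frac{\mathbb{E}[W(\tau)]}{\lambda\,\mathbb{E}[\tau]}\in[0,\infty].$$ The quantity-based policy QP with integer parameter $q\ge1$ has release time $\tau_q$. *)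

theory Defs
  imports "HOL-Probability.Probability"
begin

text \<open>Only times \<open>t \<ge> 0\<close> matter; \<open>N t\<close> is unconstrained for negative \<open>t\<close>. As paths are
  nondecreasing, the truncated subtraction on \<^typ>\<open>nat\<close> is the genuine increment.\<close>

locale poisson_process = prob_space M for M :: "'a measure" +
  fixes N :: "real \<Rightarrow> 'a \<Rightarrow> nat" and rate :: real
  assumes rate_pos: "0 < rate"
    and random_variable_N: "\<And>t. 0 \<le> t \<Longrightarrow> random_variable (count_space UNIV) (N t)"
    and start_zero: "\<And>\<omega>. \<omega> \<in> space M \<Longrightarrow> N 0 \<omega> = 0"
    and nondecreasing: "\<And>\<omega>. \<omega> \<in> space M \<Longrightarrow> mono_on {0..} (\<lambda>t. N t \<omega>)"
    and right_continuous:
      "\<And>\<omega> t. \<omega> \<in> space M \<Longrightarrow> 0 \<le> t \<Longrightarrow> continuous (at_right t) (\<lambda>u. N u \<omega>)"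
    and independent_increments:
      "\<And>(t :: nat \<Rightarrow> real) n. 0 \<le> t 0 \<Longrightarrow> mono_on {..n} t \<Longrightarrow>
        indep_vars (\<lambda>_. count_space UNIV) (\<lambda>i \<omega>. N (t (Suc i)) \<omega> - N (t i) \<omega>) {..<n}"
    and poisson_increments:
      "\<And>s t. 0 \<le> s \<Longrightarrow> s < t \<Longrightarrow>
        distr M (count_space UNIV) (\<lambda>\<omega>. N t \<omega> - N s \<omega>) = measure_pmf (poisson_pmf (rate * (t - s)))"

text \<open>Release times take values in \<open>[0, \<infinity>]\<close>, and \<^const>\<open>stopping_time\<close> wants the filtration indexed
  by the same type, so the index set is extended by \<open>\<infinity>\<close>. This does not change the notion of a
  stopping time: the condition at \<open>t = \<infinity>\<close> is trivially true.\<close>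

definition natural_filtration :: "'a measure \<Rightarrow> (real \<Rightarrow> 'a \<Rightarrow> nat) \<Rightarrow> ennreal \<Rightarrow> 'a measure" where
  "natural_filtration M N t =
    sigma (space M) {N s -` A \<inter> space M | s A. 0 \<le> s \<and> ennreal s \<le> t}"

text \<open>The value is \<open>\<infinity>\<close> if the \<open>n\<close>-th arrival never occurs.\<close>

definition arrival_time :: "(real \<Rightarrow> 'a \<Rightarrow> nat) \<Rightarrow> nat \<Rightarrow> 'a \<Rightarrow> ennreal" where
  "arrival_time N n \<omega> = Inf {ennreal t | t. 0 \<le> t \<and> n \<le> N t \<omega>}"

definition mean_cycle_length :: "'a measure \<Rightarrow> ('a \<Rightarrow> ennreal) \<Rightarrow> ennreal" where
  "mean_cycle_length M \<tau> = (\<integral>\<^sup>+ \<omega>. \<tau> \<omega> \<partial>M)"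

definition clearing_policy :: "'a measure \<Rightarrow> (real \<Rightarrow> 'a \<Rightarrow> nat) \<Rightarrow> ('a \<Rightarrow> ennreal) \<Rightarrow> bool" where
  "clearing_policy M N \<tau> \<longleftrightarrow>
    stopping_time (natural_filtration M N) \<tau> \<and>
    0 < mean_cycle_length M \<tau> \<and> mean_cycle_length M \<tau> < \<infinity>"

definition cumulative_waiting_time :: "(real \<Rightarrow> 'a \<Rightarrow> nat) \<Rightarrow> ('a \<Rightarrow> ennreal) \<Rightarrow> 'a \<Rightarrow> ennreal" where
  "cumulative_waiting_time N \<tau> \<omega> =
    (\<integral>\<^sup>+ u \<in> {u. 0 \<le> u \<and> ennreal u \<le> \<tau> \<omega>}. of_nat (N u \<omega>) \<partial>lborel)"

definition average_order_delay ::
    "'a measure \<Rightarrow> (real \<Rightarrow> 'a \<Rightarrow> nat) \<Rightarrow> real \<Rightarrow> ('a \<Rightarrow> ennreal) \<Rightarrow> ennreal" where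
  "average_order_delay M N rate \<tau> =
    (\<integral>\<^sup>+ \<omega>. cumulative_waiting_time N \<tau> \<omega> \<partial>M) / (ennreal rate * mean_cycle_length M \<tau>)"

end

theory Submission
  imports Defs
begin

text \<open>The result is a Lagrangian argument that works path by path. Among all times \<open>t\<close>, stopping
  at \<open>\<tau>\<^sub>q\<close> minimizes \<open>\<integral>\<^sub>0\<^sup>t (N(u) - c) du\<close> for every multiplier \<open>c\<close> between \<open>q - 1\<close> and \<open>q\<close>,
  since the integrand is at most \<open>0\<close> before \<open>\<tau>\<^sub>q\<close>, where \<open>N \<le> q - 1\<close>, and at least \<open>0\<close> afterwards,
  where \<open>N \<ge> q\<close>. Using \<open>c = q\<close> after \<open>\<tau>\<^sub>q\<close> and \<open>c = q - 1\<close> before it gives, with truncated differences,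
  \<open>W(\<tau>\<^sub>q) + q (\<tau> - \<tau>\<^sub>q) \<le> W(\<tau>) + (q - 1) (\<tau>\<^sub>q - \<tau>)\<close>, which is \<open>pathwise_waiting_tradeoff\<close>. The
  stopping time property enters through the measurability of \<open>\<tau>\<close>.

  As \<open>\<tau>\<close> and \<open>\<tau>\<^sub>q\<close> have the same finite mean, the two truncated differences have a common finite
  mean \<open>d\<close>, and \<open>d > 0\<close> unless \<open>\<tau> = \<tau>\<^sub>q\<close> almost surely. Taking expectations therefore yields
  \<open>E[W(\<tau>\<^sub>q)] + d \<le> E[W(\<tau>)]\<close>, which is strict improvement because \<open>E[W(\<tau>\<^sub>q)]\<close> is finite
  (\<open>arrival_time_minimizes_mean_waiting\<close>).

  The Poisson law gives the mean of \<open>\<tau>\<^sub>q\<close>: \<open>E[\<tau>\<^sub>q] = \<integral> P(N(u) < q) du\<close>, and up to a factor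
  \<open>1 / rate\<close> the probability \<open>P(N(u) = k)\<close> is, as a function of \<open>u\<close>, the \<open>k\<close>-th Erlang density,
  so each \<open>k < q\<close> contributes \<open>1 / rate\<close> (\<open>mean_arrival_time\<close>).\<close>

section \<open>Lengths of intervals with extended endpoints\<close>

lemma AE_lborel_ennreal_neq: "AE u in lborel. 0 \<le> u \<longrightarrow> ennreal u \<noteq> s"
proof -
  have "AE u in lborel. u \<noteq> enn2real s"
    by (rule AE_lborel_singleton)
  then show ?thesis
    by eventually_elim auto
qed

text \<open>For \<open>s = t = \<infinity>\<close> the interval is empty, but \<open>t - s = \<infinity>\<close> in the extended nonnegative reals,
  whence the assumption.\<close>

lemma emeasure_lborel_ennreal_interval:
  assumes "s < \<infinity>"
  shows "emeasure lborel {u. 0 \<le> u \<and> s \<le> ennreal u \<and> ennreal u < t} = t - s"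
proof -
  obtain a where a: "0 \<le> a" "s = ennreal a"
    using assms by (cases s) auto
  show ?thesis
  proof (cases t)
    case (real b)
    have set_eq: "{u. 0 \<le> u \<and> s \<le> ennreal u \<and> ennreal u < t} = {a..<b}"
      using a real by (auto simp: ennreal_less_iff)
    show ?thesis
      unfolding set_eq using a real
      by (cases "a \<le> b") (simp_all add: ennreal_minus ennreal_neg)
  next
    case top
    have "{u. 0 \<le> u \<and> s \<le> ennreal u \<and> ennreal u < t} = {a..}"
      using a top by auto
    moreover have "emeasure lborel {a..} = \<infinity>"
    proof -
      have "ennreal x \<le> emeasure lborel {a..}" if "0 \<le> x" for x
      proof -
        have "ennreal x = emeasure lborel {a..a + x}" using that by simp
        also have "\<dots> \<le> emeasure lborel {a..}" by (intro emeasure_mono) auto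
        finally show ?thesis .
      qed
      from this[of "enn2real (emeasure lborel {a..}) + 1"] show ?thesis
        by (cases "emeasure lborel {a..}") auto
    qed
    ultimately show ?thesis using top by simp
  qed
qed

context poisson_process
begin

section \<open>Arrival times and measurability\<close>

text \<open>Right-continuity makes the infimum in the arrival time attained: counts are integers, so the
  path is constant on some interval to the right of \<open>u\<close>. This turns every event about arrival times
  into one about counts, and back.\<close>

lemma arrival_time_le_iff:
  assumes \<omega>: "\<omega> \<in> space M" and u: "0 \<le> u"
  shows "arrival_time N n \<omega> \<le> ennreal u \<longleftrightarrow> n \<le> N u \<omega>"
proof
  assume le: "arrival_time N n \<omega> \<le> ennreal u"
  have "\<forall>\<^sub>F v in at_right u. N v \<omega> = N u \<omega>"
    using right_continuous[OF \<omega> u] by (simp add: continuous_within tendsto_discrete)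
  then obtain b where b: "u < b" "\<And>v. u < v \<Longrightarrow> v < b \<Longrightarrow> N v \<omega> = N u \<omega>"
    by (auto simp: eventually_at_right_field)
  have "arrival_time N n \<omega> < ennreal b"
    using le b u by (simp add: ennreal_less_iff order.strict_trans1)
  then obtain v where v: "0 \<le> v" "n \<le> N v \<omega>" "v < b"
    by (auto simp: arrival_time_def Inf_less_iff ennreal_less_iff)
  show "n \<le> N u \<omega>"
  proof (cases "v \<le> u")
    case True
    then show ?thesis
      using v u monotone_onD[OF nondecreasing[OF \<omega>], of v u] by auto
  next
    case False
    then show ?thesis using b(2)[of v] v by auto
  qed
next
  assume "n \<le> N u \<omega>"
  then show "arrival_time N n \<omega> \<le> ennreal u"
    unfolding arrival_time_def using u by (intro Inf_lower) auto
qed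

lemma measurable_arrival_time[measurable]: "arrival_time N n \<in> borel_measurable M"
proof (rule borel_measurableI_le)
  fix t :: ennreal
  show "{\<omega> \<in> space M. arrival_time N n \<omega> \<le> t} \<in> sets M"
  proof (cases t)
    case (real u)
    have [measurable]: "N u \<in> measurable M (count_space UNIV)"
      using random_variable_N real by auto
    have "{\<omega> \<in> space M. arrival_time N n \<omega> \<le> t} = {\<omega> \<in> space M. n \<le> N u \<omega>}"
      using real arrival_time_le_iff by auto
    also have "\<dots> \<in> sets M" by measurable
    finally show ?thesis .
  next
    case top
    then show ?thesis by simp
  qed
qed

text \<open>Counting the arrivals that have occurred by time \<open>u\<close> expresses \<open>N\<close> through the arrival times.
  The right-hand side depends on time and outcome by comparisons of measurable functions, from which
  the joint measurability of \<open>N\<close> is immediate.\<close>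

lemma of_nat_count_eq_suminf:
  assumes "\<omega> \<in> space M" "0 \<le> u"
  shows "(of_nat (N u \<omega>) :: ennreal) =
    (\<Sum>k. if arrival_time N (Suc k) \<omega> \<le> ennreal u then 1 else 0)"
proof -
  have "(\<Sum>k. if arrival_time N (Suc k) \<omega> \<le> ennreal u then 1 else 0 :: ennreal)
      = (\<Sum>k<N u \<omega>. if arrival_time N (Suc k) \<omega> \<le> ennreal u then 1 else 0)"
    using assms by (intro suminf_finite) (auto simp: arrival_time_le_iff)
  also have "\<dots> = (\<Sum>k<N u \<omega>. 1)"
    using assms by (intro sum.cong) (auto simp: arrival_time_le_iff)
  finally show ?thesis by simp
qed

lemma measurable_count[measurable]:
  "(\<lambda>(\<omega>, u). of_nat (N u \<omega>) * indicator {0..} u :: ennreal) \<in> borel_measurable (M \<Otimes>\<^sub>M lborel)"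
proof -
  have "(\<lambda>(\<omega>, u). of_nat (N u \<omega>) * indicator {0..} u :: ennreal) \<in> borel_measurable (M \<Otimes>\<^sub>M lborel)
    \<longleftrightarrow> (\<lambda>(\<omega>, u). (\<Sum>k. if arrival_time N (Suc k) \<omega> \<le> ennreal u then 1 else 0)
        * indicator {0..} u :: ennreal) \<in> borel_measurable (M \<Otimes>\<^sub>M lborel)"
    by (intro measurable_cong)
       (auto simp: space_pair_measure of_nat_count_eq_suminf split: split_indicator)
  also have "\<dots>" by measurable
  finally show ?thesis .
qed

lemma cumulative_waiting_time_eq:
  "cumulative_waiting_time N \<tau> \<omega> =
    (\<integral>\<^sup>+ u. of_nat (N u \<omega>) * indicator {0..} u * indicator {u. ennreal u \<le> \<tau> \<omega>} u \<partial>lborel)"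
  unfolding cumulative_waiting_time_def
  by (intro nn_integral_cong) (auto split: split_indicator)

lemma measurable_cumulative_waiting_time[measurable]:
  assumes [measurable]: "\<tau> \<in> borel_measurable M"
  shows "cumulative_waiting_time N \<tau> \<in> borel_measurable M"
proof -
  have "(\<lambda>\<omega>. \<integral>\<^sup>+ u. of_nat (N u \<omega>) * indicator {0..} u * indicator {u. ennreal u \<le> \<tau> \<omega>} u \<partial>lborel)
      \<in> borel_measurable M"
    by measurable
  then show ?thesis
    by (simp add: cumulative_waiting_time_eq[abs_def])
qed

lemma clearing_policy_measurable:
  assumes "clearing_policy M N \<tau>"
  shows "\<tau> \<in> borel_measurable M"
proof (rule measurable_stopping_time)
  show "stopping_time (natural_filtration M N) \<tau>"
    using assms by (simp add: clearing_policy_def)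
  show "space (natural_filtration M N t) = space M" for t
    by (auto simp: natural_filtration_def intro!: space_measure_of)
  have "{N s -` A \<inter> space M | s A. 0 \<le> s \<and> ennreal s \<le> t} \<subseteq> sets M" for t
    using random_variable_N by (auto intro: measurable_sets)
  then show "sets (natural_filtration M N t) \<subseteq> sets M" for t
    unfolding natural_filtration_def
    by (subst sets_measure_of) (auto intro!: sets.sigma_sets_subset dest: sets.sets_into_space)
qed

section \<open>The pathwise trade-off\<close>

text \<open>Running on from \<open>\<tau>\<^sub>q\<close> to a later time costs at least \<open>q\<close> per unit of time, since \<open>q\<close> orders are
  already waiting, while dispatching before \<open>\<tau>\<^sub>q\<close> saves at most \<open>q - 1\<close> per unit of time. Both cases
  fit in one inequality because one of the truncated differences vanishes.\<close>

lemma pathwise_waiting_tradeoff: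
  fixes \<tau> :: "'a \<Rightarrow> ennreal"
  assumes \<omega>: "\<omega> \<in> space M" and fin: "arrival_time N q \<omega> < \<infinity>" "\<tau> \<omega> < \<infinity>"
  shows "cumulative_waiting_time N (arrival_time N q) \<omega> + of_nat q * (\<tau> \<omega> - arrival_time N q \<omega>)
      \<le> cumulative_waiting_time N \<tau> \<omega> + of_nat (q - 1) * (arrival_time N q \<omega> - \<tau> \<omega>)"
proof -
  define s t where st: "s = arrival_time N q \<omega>" "t = \<tau> \<omega>"
  define I where "I a b = {u. 0 \<le> u \<and> a \<le> ennreal u \<and> ennreal u < b}" for a b
  have I_meas[measurable]: "I a b \<in> sets lborel" for a b
    unfolding I_def by measurable
  have len: "(\<integral>\<^sup>+ u. of_nat c * indicator (I a b) u \<partial>lborel) = of_nat c * (b - a)"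
    if "a < \<infinity>" for a b :: ennreal and c :: nat
    using emeasure_lborel_ennreal_interval[OF that, of b] nn_integral_cmult_indicator[OF I_meas]
    by (simp add: I_def)
  have path[measurable]:
    "(\<lambda>u. of_nat (N u \<omega>) * indicator {0..} u :: ennreal) \<in> borel_measurable lborel"
    using measurable_compose[OF measurable_Pair1'[OF \<omega>] measurable_count] by simp
  have N_s: "s \<le> ennreal u \<longleftrightarrow> q \<le> N u \<omega>" if "0 \<le> u" for u
    using arrival_time_le_iff[OF \<omega> that] by (simp add: st)
  have "(\<integral>\<^sup>+ u. of_nat (N u \<omega>) * indicator {0..} u * indicator {u. ennreal u \<le> s} u
          + of_nat q * indicator (I s t) u \<partial>lborel)
      \<le> (\<integral>\<^sup>+ u. of_nat (N u \<omega>) * indicator {0..} u * indicator {u. ennreal u \<le> t} u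
          + of_nat (q - 1) * indicator (I t s) u \<partial>lborel)"
  proof (rule nn_integral_mono_AE)
    \<comment> \<open>The integrands compare except at \<open>u = s\<close>: there the count is already \<open>q\<close>, but for \<open>t < s\<close> the
      right-hand interval excludes its endpoint \<open>s\<close>.\<close>
    show "AE u in lborel. of_nat (N u \<omega>) * indicator {0..} u * indicator {u. ennreal u \<le> s} u
          + of_nat q * indicator (I s t) u
      \<le> (of_nat (N u \<omega>) * indicator {0..} u * indicator {u. ennreal u \<le> t} u
          + of_nat (q - 1) * indicator (I t s) u :: ennreal)"
      using AE_lborel_ennreal_neq[of s]
    proof eventually_elim
      case (elim u)
      show ?case
      proof (cases "0 \<le> u")
        case u: True
        show ?thesis
        proof (cases "s \<le> ennreal u")
          case True
          then show ?thesis
            using u elim N_s[OF u] by (auto simp: I_def not_le split: split_indicator)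
        next
          case False
          then have "N u \<omega> \<le> q - 1" using N_s[OF u] by auto
          with False u show ?thesis
            by (auto simp: I_def split: split_indicator)
        qed
      qed (simp add: I_def)
    qed
  qed
  then show ?thesis
    using fin by (simp add: nn_integral_add len cumulative_waiting_time_eq st)
qed

section \<open>The mean arrival time\<close>

text \<open>The Poisson probability of \<open>k\<close> arrivals by time \<open>u\<close> is \<open>1 / rate\<close> times the Erlang density of
  order \<open>k\<close> at \<open>u\<close>, and Erlang densities integrate to \<open>1\<close>.\<close>

lemma nn_integral_probability_few_arrivals:
  "(\<integral>\<^sup>+ u. indicator {0..} u * emeasure M {\<omega> \<in> space M. N u \<omega> < n} \<partial>lborel) = ennreal (real n / rate)"
proof -
  \<comment> \<open>The increment law is given for intervals of positive length; the point \<open>u = 0\<close> is negligible.\<close>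
  have pois: "indicator {0..} u * emeasure M {\<omega> \<in> space M. N u \<omega> < n}
      = (\<Sum>k<n. ennreal (1 / rate) * ennreal (erlang_density k rate u))" if "u \<noteq> 0" for u
  proof (cases "0 < u")
    case u: True
    have meas[measurable]: "N u \<in> measurable M (count_space UNIV)"
      using random_variable_N u by auto
    have N0: "N u \<omega> - N 0 \<omega> = N u \<omega>" if "\<omega> \<in> space M" for \<omega>
      using start_zero[OF that] by simp
    have "distr M (count_space UNIV) (N u) = distr M (count_space UNIV) (\<lambda>\<omega>. N u \<omega> - N 0 \<omega>)"
      by (intro distr_cong) (auto simp: N0)
    also have "\<dots> = measure_pmf (poisson_pmf (rate * u))"
      using poisson_increments[of 0 u] u by simp
    finally have D: "distr M (count_space UNIV) (N u) = measure_pmf (poisson_pmf (rate * u))" .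
    have "emeasure M {\<omega> \<in> space M. N u \<omega> < n} = emeasure (distr M (count_space UNIV) (N u)) {..<n}"
      by (subst emeasure_distr) (auto intro!: arg_cong[where f="emeasure M"])
    also have "\<dots> = (\<Sum>k<n. ennreal (pmf (poisson_pmf (rate * u)) k))"
      unfolding D by (subst emeasure_measure_pmf_finite) auto
    also have "\<dots> = (\<Sum>k<n. ennreal (1 / rate) * ennreal (erlang_density k rate u))"
      using u rate_pos
      by (intro sum.cong refl)
         (auto simp: erlang_density_def ennreal_mult[symmetric] power_mult_distrib field_simps)
    finally show ?thesis using u by simp
  qed (use that in \<open>simp add: erlang_density_def\<close>)
  have erlang: "(\<integral>\<^sup>+ u. ennreal (erlang_density k rate u) \<partial>lborel) = 1" for k
    using nn_integral_erlang_ith_moment[OF rate_pos, of k 0] by simp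
  have "(\<integral>\<^sup>+ u. indicator {0..} u * emeasure M {\<omega> \<in> space M. N u \<omega> < n} \<partial>lborel)
      = (\<integral>\<^sup>+ u. (\<Sum>k<n. ennreal (1 / rate) * ennreal (erlang_density k rate u)) \<partial>lborel)"
    using AE_lborel_singleton[of 0]
    by (intro nn_integral_cong_AE) (auto elim!: eventually_mono intro!: pois)
  also have "\<dots> = of_nat n * ennreal (1 / rate)"
    by (simp add: nn_integral_sum nn_integral_cmult erlang)
  also have "\<dots> = ennreal (real n / rate)"
    using rate_pos by (simp add: ennreal_of_nat_eq_real_of_nat ennreal_mult[symmetric])
  finally show ?thesis .
qed

text \<open>Tonelli: the length of \<open>[0, \<tau>\<^sub>n)\<close> has mean \<open>\<integral> P(u < \<tau>\<^sub>n) du\<close>, and \<open>u < \<tau>\<^sub>n\<close> means that fewer than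
  \<open>n\<close> orders have arrived by time \<open>u\<close>.\<close>

lemma mean_arrival_time: "mean_cycle_length M (arrival_time N n) = ennreal (real n / rate)"
proof -
  interpret pair_sigma_finite M lborel ..
  let ?B = "\<lambda>\<omega>. {u. 0 \<le> u \<and> 0 \<le> ennreal u \<and> ennreal u < arrival_time N n \<omega>}"
  have "mean_cycle_length M (arrival_time N n) = (\<integral>\<^sup>+ \<omega>. (\<integral>\<^sup>+ u. indicator (?B \<omega>) u \<partial>lborel) \<partial>M)"
    unfolding mean_cycle_length_def
    using emeasure_lborel_ennreal_interval[of 0] by (intro nn_integral_cong) simp
  also have "\<dots> = (\<integral>\<^sup>+ u. (\<integral>\<^sup>+ \<omega>. indicator (?B \<omega>) u \<partial>M) \<partial>lborel)"
    by (intro Fubini'[symmetric]) measurable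
  also have "\<dots> = (\<integral>\<^sup>+ u. indicator {0..} u * emeasure M {\<omega> \<in> space M. N u \<omega> < n} \<partial>lborel)"
  proof (intro nn_integral_cong)
    fix u :: real
    show "(\<integral>\<^sup>+ \<omega>. indicator (?B \<omega>) u \<partial>M)
        = indicator {0..} u * emeasure M {\<omega> \<in> space M. N u \<omega> < n}"
    proof (cases "0 \<le> u")
      case True
      then have [measurable]: "N u \<in> measurable M (count_space UNIV)"
        using random_variable_N by auto
      have "(\<integral>\<^sup>+ \<omega>. indicator (?B \<omega>) u \<partial>M)
          = (\<integral>\<^sup>+ \<omega>. indicator {\<omega> \<in> space M. N u \<omega> < n} \<omega> \<partial>M)"
        using True arrival_time_le_iff
        by (intro nn_integral_cong) (auto simp: not_le[symmetric] split: split_indicator)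
      also have "\<dots> = emeasure M {\<omega> \<in> space M. N u \<omega> < n}"
        by (subst nn_integral_indicator) auto
      finally show ?thesis using True by simp
    qed simp
  qed
  finally show ?thesis
    by (simp add: nn_integral_probability_few_arrivals)
qed

section \<open>Optimality in the mean\<close>

text \<open>Equal finite means force the overshoot \<open>\<tau> - \<tau>\<^sub>q\<close> and the undershoot \<open>\<tau>\<^sub>q - \<tau>\<close> to have equal
  means \<open>d = e\<close>; the trade-off charges \<open>q\<close> for the one and refunds only \<open>q - 1\<close> for the other, which
  leaves a loss of \<open>d\<close>.\<close>

lemma arrival_time_minimizes_mean_waiting:
  assumes q: "1 \<le> q" and [measurable]: "\<tau> \<in> borel_measurable M"
    and mean: "(\<integral>\<^sup>+ \<omega>. \<tau> \<omega> \<partial>M) = (\<integral>\<^sup>+ \<omega>. arrival_time N q \<omega> \<partial>M)"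
    and neq: "0 < measure M {\<omega> \<in> space M. \<tau> \<omega> \<noteq> arrival_time N q \<omega>}"
  shows "(\<integral>\<^sup>+ \<omega>. cumulative_waiting_time N (arrival_time N q) \<omega> \<partial>M)
    < (\<integral>\<^sup>+ \<omega>. cumulative_waiting_time N \<tau> \<omega> \<partial>M)"
proof -
  let ?s = "arrival_time N q"
  let ?EW = "\<lambda>\<tau>. \<integral>\<^sup>+ \<omega>. cumulative_waiting_time N \<tau> \<omega> \<partial>M"
  define d where "d = (\<integral>\<^sup>+ \<omega>. \<tau> \<omega> - ?s \<omega> \<partial>M)"
  define e where "e = (\<integral>\<^sup>+ \<omega>. ?s \<omega> - \<tau> \<omega> \<partial>M)"
  have mean_fin: "(\<integral>\<^sup>+ \<omega>. ?s \<omega> \<partial>M) < \<infinity>"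
    using mean_arrival_time[of q] by (simp add: mean_cycle_length_def)
  have s_fin: "AE \<omega> in M. ?s \<omega> < \<infinity>"
    using mean_fin nn_integral_PInf_AE[of ?s M] by (simp add: less_top)
  have t_fin: "AE \<omega> in M. \<tau> \<omega> < \<infinity>"
    using mean_fin mean nn_integral_PInf_AE[of \<tau> M] by (simp add: less_top)
  \<comment> \<open>Both sums below are the integral of the maximum of \<open>\<tau>\<close> and \<open>\<tau>\<^sub>q\<close>.\<close>
  have "(\<integral>\<^sup>+ \<omega>. ?s \<omega> \<partial>M) + d = (\<integral>\<^sup>+ \<omega>. ?s \<omega> + (\<tau> \<omega> - ?s \<omega>) \<partial>M)"
    unfolding d_def by (rule nn_integral_add[symmetric]) auto
  also have "\<dots> = (\<integral>\<^sup>+ \<omega>. \<tau> \<omega> + (?s \<omega> - \<tau> \<omega>) \<partial>M)"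
    by (intro nn_integral_cong) (auto simp: add_diff_self_ennreal)
  also have "\<dots> = (\<integral>\<^sup>+ \<omega>. ?s \<omega> \<partial>M) + e"
    unfolding e_def mean[symmetric] by (rule nn_integral_add) auto
  finally have de: "d = e"
    using mean_fin by auto
  have "e \<le> (\<integral>\<^sup>+ \<omega>. ?s \<omega> \<partial>M)"
    unfolding e_def by (intro nn_integral_mono) simp
  with mean_fin have e_fin: "e < \<infinity>" by simp
  have d_pos: "d \<noteq> 0"
  proof
    assume "d = 0"
    with de have "e = 0" by simp
    have "AE \<omega> in M. \<tau> \<omega> - ?s \<omega> = 0"
      using \<open>d = 0\<close> by (simp add: d_def nn_integral_0_iff_AE)
    moreover have "AE \<omega> in M. ?s \<omega> - \<tau> \<omega> = 0"
      using \<open>e = 0\<close> by (simp add: e_def nn_integral_0_iff_AE)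
    ultimately have "AE \<omega> in M. \<not> \<tau> \<omega> \<noteq> ?s \<omega>"
      by eventually_elim (auto simp: diff_eq_0_iff_ennreal)
    then have "prob {\<omega> \<in> space M. \<tau> \<omega> \<noteq> ?s \<omega>} = 0"
      by (subst prob_eq_0) auto
    with neq show False by simp
  qed
  \<comment> \<open>The bound \<open>W(\<tau>\<^sub>q) \<le> (q - 1) \<tau>\<^sub>q\<close> is the trade-off against dispatching at time \<open>0\<close>.\<close>
  have "?EW ?s \<le> (\<integral>\<^sup>+ \<omega>. of_nat (q - 1) * ?s \<omega> \<partial>M)"
  proof (rule nn_integral_mono_AE)
    show "AE \<omega> in M. cumulative_waiting_time N ?s \<omega> \<le> of_nat (q - 1) * ?s \<omega>"
      using s_fin AE_space
    proof eventually_elim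
      case (elim \<omega>)
      have "cumulative_waiting_time N (\<lambda>_. 0) \<omega> = (\<integral>\<^sup>+ u. 0 \<partial>(lborel :: real measure))"
        unfolding cumulative_waiting_time_def using start_zero[OF elim(2)]
        by (intro nn_integral_cong) (auto split: split_indicator)
      then show ?case
        using pathwise_waiting_tradeoff[OF elim(2,1), of "\<lambda>_. 0"] by simp
    qed
  qed
  also have "\<dots> < \<infinity>"
    using mean_fin by (simp add: nn_integral_cmult ennreal_mult_less_top of_nat_less_top)
  finally have W_fin: "?EW ?s < \<infinity>" .
  have "?EW ?s + of_nat q * d
      = (\<integral>\<^sup>+ \<omega>. cumulative_waiting_time N ?s \<omega> + of_nat q * (\<tau> \<omega> - ?s \<omega>) \<partial>M)"
    unfolding d_def by (simp add: nn_integral_add nn_integral_cmult)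
  also have "\<dots> \<le> (\<integral>\<^sup>+ \<omega>. cumulative_waiting_time N \<tau> \<omega> + of_nat (q - 1) * (?s \<omega> - \<tau> \<omega>) \<partial>M)"
    using s_fin t_fin AE_space
    by (intro nn_integral_mono_AE, eventually_elim) (rule pathwise_waiting_tradeoff)
  also have "\<dots> = ?EW \<tau> + of_nat (q - 1) * e"
    unfolding e_def by (simp add: nn_integral_add nn_integral_cmult)
  finally have "?EW ?s + of_nat q * d \<le> ?EW \<tau> + of_nat (q - 1) * d"
    using de by simp
  moreover have "of_nat q * d = d + of_nat (q - 1) * d"
    using q by (cases q) (auto simp: distrib_right)
  ultimately have "of_nat (q - 1) * d + (?EW ?s + d) \<le> of_nat (q - 1) * d + ?EW \<tau>"
    by (simp add: ac_simps)
  then have gap: "?EW ?s + d \<le> ?EW \<tau>"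
    using e_fin de by (auto simp: ennreal_add_left_cancel_le ennreal_mult_eq_top_iff)
  have "?EW ?s + 0 < ?EW ?s + d"
    using W_fin d_pos by (subst ennreal_add_left_cancel_less) (auto simp: zero_less_iff_neq_zero)
  then have "?EW ?s < ?EW ?s + d"
    by (simp only: add_0_right)
  also note gap
  finally show ?thesis .
qed

end

theorem theorem5p1:
  fixes M :: "'a measure" and N :: "real \<Rightarrow> 'a \<Rightarrow> nat" and rate :: real
    and q :: nat and \<tau> :: "'a \<Rightarrow> ennreal"
  assumes "poisson_process M N rate"
    and "1 \<le> q"
    and "clearing_policy M N \<tau>"
    and "mean_cycle_length M \<tau> = mean_cycle_length M (arrival_time N q)"
  shows "mean_cycle_length M (arrival_time N q) = ennreal (real q / rate) \<and>
    (0 < measure M {\<omega> \<in> space M. \<tau> \<omega> \<noteq> arrival_time N q \<omega>} \<longrightarrow>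
      average_order_delay M N rate (arrival_time N q) < average_order_delay M N rate \<tau>)"
proof (intro conjI impI)
  interpret poisson_process M N rate by fact
  show mean: "mean_cycle_length M (arrival_time N q) = ennreal (real q / rate)"
    by (rule mean_arrival_time)
  assume "0 < measure M {\<omega> \<in> space M. \<tau> \<omega> \<noteq> arrival_time N q \<omega>}"
  then have less: "(\<integral>\<^sup>+ \<omega>. cumulative_waiting_time N (arrival_time N q) \<omega> \<partial>M)
      < (\<integral>\<^sup>+ \<omega>. cumulative_waiting_time N \<tau> \<omega> \<partial>M)"
    using assms clearing_policy_measurable
    by (intro arrival_time_minimizes_mean_waiting) (auto simp: mean_cycle_length_def)
  have "ennreal rate * mean_cycle_length M (arrival_time N q) = ennreal (real q)"
    using rate_pos by (simp add: mean ennreal_mult[symmetric])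
  then show "average_order_delay M N rate (arrival_time N q) < average_order_delay M N rate \<tau>"
    unfolding average_order_delay_def assms(4) using less assms(2)
    by (simp add: divide_less_ennreal ennreal_divide_times)
qed

end
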